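(* Let $q\in(0,1)$ and $0<a<b$. Let $f,g:[0,b]\to\mathbb{R}$ be two bounded functions such that $m\le f(x)\le M$ and $\varphi\le g(x)\le\Phi$ for all $x\in[0,b]$, where $m,M,\varphi,\Phi$ are given real constants. Then $$\left|\frac{1}{b-a}I_q(fg;a,b)-\frac{1}{(b-a)^2}I_q(f;a,b)\,I_q(g;a,b)\right|\le\frac14(M-m)(\Phi-\varphi)\left(1+\frac{4ab}{(b-a)^2}\right).$$
   Context: For $q\in(0,1)$ and $c>0$, $I_q(h;0,c)=c(1-q)\sum_{k=0}^{\infty}h(cq^k)q^k$, and for $0<a<b$, $I_q(h;a,b)=I_q(h;0,b)-I_q(h;0,a)$. *)

theory Defs
  imports "HOL-Analysis.Analysis"
begin

text \<open>The Jackson \<open>q\<close>-integral. The series converges absolutely whenever \<open>0 < q < 1\<close> and \<open>h\<close> is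
  bounded on \<open>{0..c}\<close>; only the values of \<open>h\<close> at the nodes \<open>c * q ^ k\<close>, which lie in \<open>{0..c}\<close>, matter.\<close>

definition q_integral0 :: "real \<Rightarrow> (real \<Rightarrow> real) \<Rightarrow> real \<Rightarrow> real" where
  "q_integral0 q h c = c * (1 - q) * (\<Sum>k. h (c * q ^ k) * q ^ k)"

definition q_integral :: "real \<Rightarrow> (real \<Rightarrow> real) \<Rightarrow> real \<Rightarrow> real \<Rightarrow> real" where
  "q_integral q h a b = q_integral0 q h b - q_integral0 q h a"

end

theory Submission
  imports Defs
begin

text \<open>Write \<open>J\<^sub>c h\<close> for the \<open>q\<close>-integral of \<open>h\<close> over \<open>{0..c}\<close>. On bounded functions it is a positive
  linear functional of total mass \<open>c\<close>, and the integral over \<open>{a..b}\<close> is the difference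
  \<open>J\<^sub>b - J\<^sub>a\<close>, a signed functional whose total variation has mass at most \<open>a + b\<close>. After
  multiplication by \<open>(b - a)\<^sup>2\<close>, the quantity to be estimated is the covariance
  \<open>T = (b - a) (J\<^sub>b - J\<^sub>a) (f g) - (J\<^sub>b - J\<^sub>a) f (J\<^sub>b - J\<^sub>a) g\<close> of the signed functional, and the
  bound is \<open>(M - m) (\<Phi> - \<phi>) (a + b)\<^sup>2 / 4\<close>, because \<open>(b - a)\<^sup>2 + 4 a b = (a + b)\<^sup>2\<close>.

  Let \<open>V h = (a + b) (J\<^sub>b + J\<^sub>a) (h\<^sup>2) - ((J\<^sub>b + J\<^sub>a) h)\<^sup>2\<close> be the variance, scaled by
  \<open>(a + b)\<^sup>2\<close>, of the positive functional \<open>J\<^sub>b + J\<^sub>a\<close>. As a double integral, \<open>T\<close> has the integrand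
  \<open>(f x - f y) (g x - g y) / 2\<close> against the square of the signed functional; replacing that square
  by its absolute value and applying Cauchy-Schwarz gives \<open>T\<^sup>2 \<le> V f * V g\<close>
  (lemma \<open>covariance_sq_le_variance_mult\<close>). The proof below needs no double series: the quadratic
  polynomial \<open>V f + 2 t T + t\<^sup>2 V g\<close> is a sum of expressions that are nonnegative by positivity of
  \<open>J\<^sub>a\<close> and \<open>J\<^sub>b\<close>. The classical argument behind the Gruess inequality, namely
  \<open>(M - f) (f - m) \<ge> 0\<close>, gives \<open>V f \<le> ((a + b) (M - m) / 2)\<^sup>2\<close>
  (lemma \<open>q_integral0_variance_le\<close>), and likewise for \<open>g\<close>.\<close>

section \<open>The Jackson integral as a positive linear functional\<close>

lemma q_integral0_summable:
  fixes h :: "real \<Rightarrow> real"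
  assumes "0 < q" "q < 1" "0 \<le> c" "bounded (h ` {0..c})"
  shows "summable (\<lambda>k. h (c * q ^ k) * q ^ k)"
proof -
  obtain B where B: "\<And>x. x \<in> {0..c} \<Longrightarrow> \<bar>h x\<bar> \<le> B"
    using assms(4) unfolding bounded_iff by fastforce
  have "norm (h (c * q ^ k) * q ^ k) \<le> B * q ^ k" for k
  proof -
    have "q ^ k \<le> 1" using assms by (simp add: power_le_one)
    then have "c * q ^ k \<in> {0..c}" using assms by (auto simp: mult_left_le)
    from B[OF this] show ?thesis using assms by (simp add: abs_mult mult_right_mono)
  qed
  moreover have "summable (\<lambda>k. B * q ^ k)"
    using assms by (intro summable_mult summable_geometric) auto
  ultimately show ?thesis by (rule summable_comparison_test'[of _ 0, rotated])
qed

lemma q_integral0_const: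
  assumes "0 < q" "q < 1"
  shows "q_integral0 q (\<lambda>x. k) c = k * c"
  using assms suminf_geometric[of q]
  by (simp add: q_integral0_def suminf_mult summable_geometric)

lemma q_integral0_add:
  assumes "0 < q" "q < 1" "0 \<le> c" "bounded (h ` {0..c})" "bounded (h' ` {0..c})"
  shows "q_integral0 q (\<lambda>x. h x + h' x) c = q_integral0 q h c + q_integral0 q h' c"
  using suminf_add[OF q_integral0_summable[of q c h] q_integral0_summable[of q c h'], symmetric] assms
  by (simp add: q_integral0_def distrib_right distrib_left)

lemma q_integral0_cmult:
  assumes "0 < q" "q < 1" "0 \<le> c" "bounded (h ` {0..c})"
  shows "q_integral0 q (\<lambda>x. r * h x) c = r * q_integral0 q h c"
  using suminf_mult[OF q_integral0_summable[of q c h], of r] assms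
  by (simp add: q_integral0_def algebra_simps)

lemma q_integral0_nonneg:
  assumes "0 < q" "q < 1" "0 \<le> c" "bounded (h ` {0..c})" "\<And>x. x \<in> {0..c} \<Longrightarrow> 0 \<le> h x"
  shows "0 \<le> q_integral0 q h c"
proof -
  have "0 \<le> h (c * q ^ k) * q ^ k" for k
  proof -
    have "q ^ k \<le> 1" using assms by (simp add: power_le_one)
    then have "c * q ^ k \<in> {0..c}" using assms by (auto simp: mult_left_le)
    from assms(5)[OF this] show ?thesis using assms(1) by simp
  qed
  then have "0 \<le> (\<Sum>k. h (c * q ^ k) * q ^ k)"
    by (intro suminf_nonneg q_integral0_summable assms)
  then show ?thesis using assms by (simp add: q_integral0_def)
qed

lemma bounded_image_mult:
  fixes h h' :: "'a \<Rightarrow> real"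
  assumes "bounded (h ` S)" "bounded (h' ` S)"
  shows "bounded ((\<lambda>x. h x * h' x) ` S)"
proof -
  obtain B where B: "\<And>x. x \<in> S \<Longrightarrow> \<bar>h x\<bar> \<le> B"
    using assms(1) unfolding bounded_iff by fastforce
  obtain B' where B': "\<And>x. x \<in> S \<Longrightarrow> \<bar>h' x\<bar> \<le> B'"
    using assms(2) unfolding bounded_iff by fastforce
  have "\<bar>h x * h' x\<bar> \<le> B * B'" if "x \<in> S" for x
    unfolding abs_mult
    using mult_mono'[OF B[OF that] B'[OF that]] by simp
  then show ?thesis unfolding bounded_iff by (intro exI[of _ "B * B'"]) auto
qed

lemma bounded_image_cmult:
  fixes h :: "'a \<Rightarrow> real"
  assumes "bounded (h ` S)"
  shows "bounded ((\<lambda>x. r * h x) ` S)"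
  using bounded_scaling[OF assms, of r] by (simp add: image_image)

lemma bounded_image_const: "bounded ((\<lambda>x. r :: real) ` S)"
  by (rule finite_imp_bounded, rule finite_subset[of _ "{r}"]) auto

section \<open>Moment inequalities on a single interval\<close>

text \<open>Positivity of \<open>J\<^sub>c\<close> on the square of an affine combination \<open>f + s g + r\<close>, expanded into
  first and second moments. This is the only form in which positivity enters the Cauchy-Schwarz
  argument.\<close>

lemma q_integral0_square_nonneg:
  assumes q: "0 < q" "q < 1" "0 \<le> c" and bd: "bounded (f ` {0..c})" "bounded (g ` {0..c})"
  shows "0 \<le> q_integral0 q (\<lambda>x. f x * f x) c + 2 * s * q_integral0 q (\<lambda>x. f x * g x) c
           + s\<^sup>2 * q_integral0 q (\<lambda>x. g x * g x) c
           + 2 * r * (q_integral0 q f c + s * q_integral0 q g c) + r\<^sup>2 * c"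
proof -
  note bdI = bounded_image_mult bounded_image_cmult bounded_image_const bounded_plus_comp bd
  let ?e = "\<lambda>x. f x * f x + (2 * s * (f x * g x) + (s\<^sup>2 * (g x * g x)
              + (2 * r * f x + (2 * r * s * g x + r\<^sup>2))))"
  have "?e x = (f x + s * g x + r)\<^sup>2" for x
    by (simp add: power2_eq_square algebra_simps)
  then have "0 \<le> q_integral0 q ?e c"
    by (intro q_integral0_nonneg q bdI) simp
  also have "q_integral0 q ?e c = q_integral0 q (\<lambda>x. f x * f x) c
      + (2 * s * q_integral0 q (\<lambda>x. f x * g x) c + (s\<^sup>2 * q_integral0 q (\<lambda>x. g x * g x) c
      + (2 * r * q_integral0 q f c + (2 * r * s * q_integral0 q g c + r\<^sup>2 * c))))"
    by (simp only: q_integral0_add q_integral0_cmult q_integral0_const q bdI)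
  finally show ?thesis by (simp add: algebra_simps)
qed

text \<open>Integrated form of \<open>(M - f) (f - m) \<ge> 0\<close>.\<close>

lemma q_integral0_square_le:
  assumes q: "0 < q" "q < 1" "0 \<le> c" and bd: "bounded (f ` {0..c})"
    and "\<And>x. x \<in> {0..c} \<Longrightarrow> m \<le> f x \<and> f x \<le> M"
  shows "q_integral0 q (\<lambda>x. f x * f x) c \<le> (M + m) * q_integral0 q f c - m * M * c"
proof -
  note bdI = bounded_image_mult bounded_image_cmult bounded_image_const bounded_plus_comp bd
  let ?e = "\<lambda>x. (M + m) * f x + ((-1) * (f x * f x) + (- m * M))"
  have "?e x = (M - f x) * (f x - m)" for x
    by (simp add: algebra_simps)
  then have "0 \<le> q_integral0 q ?e c"
    using assms(5) by (intro q_integral0_nonneg q bdI) simp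
  also have "q_integral0 q ?e c
      = (M + m) * q_integral0 q f c + ((-1) * q_integral0 q (\<lambda>x. f x * f x) c + (- m * M) * c)"
    by (simp only: q_integral0_add q_integral0_cmult q_integral0_const q bdI)
  finally show ?thesis by simp
qed

lemma sq_le_mult_of_quadratic_nonneg:
  fixes A B C :: real
  assumes nonneg: "\<And>t. 0 \<le> A + 2 * t * B + t\<^sup>2 * C" and "0 \<le> C"
  shows "B\<^sup>2 \<le> A * C"
proof (cases "C = 0")
  case True
  have "B = 0"
  proof (rule ccontr)
    assume "B \<noteq> 0"
    then show False
      using nonneg[of "- (A + 1) / (2 * B)"] True by (simp add: field_simps)
  qed
  then show ?thesis using True by simp
next
  case False
  with \<open>0 \<le> C\<close> have "0 < C" by simp
  then show ?thesis
    using nonneg[of "- B / C"] by (simp add: field_simps power2_eq_square)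
qed

section \<open>Variance and covariance on a pair of intervals\<close>

lemma q_integral0_variance_le:
  assumes q: "0 < q" "q < 1" "0 \<le> a" "a \<le> b" and bd: "bounded (f ` {0..b})"
    and f: "\<And>x. x \<in> {0..b} \<Longrightarrow> m \<le> f x \<and> f x \<le> M"
  shows "(a + b) * (q_integral0 q (\<lambda>x. f x * f x) b + q_integral0 q (\<lambda>x. f x * f x) a)
           - (q_integral0 q f b + q_integral0 q f a)\<^sup>2 \<le> ((a + b) * (M - m) / 2)\<^sup>2"
    (is "(a + b) * (?B + ?A) - ?F\<^sup>2 \<le> _")
proof -
  have bda: "bounded (f ` {0..a})"
    by (rule bounded_subset[OF bd]) (use q in auto)
  have "?B \<le> (M + m) * q_integral0 q f b - m * M * b"
    by (rule q_integral0_square_le) (use q bd f in auto)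
  moreover have "?A \<le> (M + m) * q_integral0 q f a - m * M * a"
    by (rule q_integral0_square_le) (use q bda f in auto)
  ultimately have "?B + ?A \<le> (M + m) * ?F - m * M * (a + b)"
    by (simp add: algebra_simps)
  then have "(a + b) * (?B + ?A) \<le> (a + b) * ((M + m) * ?F - m * M * (a + b))"
    using q by (intro mult_left_mono) auto
  moreover have "((a + b) * (M - m) / 2)\<^sup>2 - ((a + b) * ((M + m) * ?F - m * M * (a + b)) - ?F\<^sup>2)
      = (?F - (a + b) * (M + m) / 2)\<^sup>2"
    by (simp add: power2_eq_square field_simps)
  ultimately show ?thesis
    using zero_le_power2[of "?F - (a + b) * (M + m) / 2"] by linarith
qed

lemma q_integral0_variance_nonneg:
  assumes q: "0 < q" "q < 1" "0 \<le> a" "a \<le> b" and bd: "bounded (g ` {0..b})"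
  shows "0 \<le> (a + b) * (q_integral0 q (\<lambda>x. g x * g x) b + q_integral0 q (\<lambda>x. g x * g x) a)
           - (q_integral0 q g b + q_integral0 q g a)\<^sup>2"
    (is "0 \<le> (a + b) * (?B + ?A) - ?G\<^sup>2")
proof -
  have bda: "bounded (g ` {0..a})"
    by (rule bounded_subset[OF bd]) (use q in auto)
  have "0 \<le> (?B + ?A) + 2 * r * ?G + r\<^sup>2 * (a + b)" for r
  proof -
    have "0 \<le> ?B + 2 * r * q_integral0 q g b + r\<^sup>2 * b"
      using q_integral0_square_nonneg[of q b g g 0 r] q bd by simp
    moreover have "0 \<le> ?A + 2 * r * q_integral0 q g a + r\<^sup>2 * a"
      using q_integral0_square_nonneg[of q a g g 0 r] q bda by simp
    ultimately show ?thesis by (simp add: algebra_simps)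
  qed
  then have "?G\<^sup>2 \<le> (?B + ?A) * (a + b)"
    by (rule sq_le_mult_of_quadratic_nonneg) (use q in auto)
  then show ?thesis by (simp add: mult.commute)
qed

text \<open>In the double-integral picture, the three nonnegative terms in the proof are the
  contributions of \<open>J\<^sub>b\<close> with itself, of \<open>J\<^sub>a\<close> with itself, and of the mixed pairs. The signed
  product functional is negative on the mixed pairs, which is why \<open>f - t g\<close> appears there
  in place of \<open>f + t g\<close>.\<close>

lemma covariance_sq_le_variance_mult:
  assumes q: "0 < q" "q < 1" "0 < a" "a \<le> b"
    and bd: "bounded (f ` {0..b})" "bounded (g ` {0..b})"
  defines "J \<equiv> \<lambda>h c. q_integral0 q h c"
  defines "V \<equiv> \<lambda>h. (a + b) * (J (\<lambda>x. h x * h x) b + J (\<lambda>x. h x * h x) a) - (J h b + J h a)\<^sup>2"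
  shows "((b - a) * (J (\<lambda>x. f x * g x) b - J (\<lambda>x. f x * g x) a)
            - (J f b - J f a) * (J g b - J g a))\<^sup>2 \<le> V f * V g"
proof -
  have bda: "bounded (f ` {0..a})" "bounded (g ` {0..a})"
    by (rule bounded_subset[OF bd(1)] bounded_subset[OF bd(2)]; use q in auto)+
  define Q where "Q s c = J (\<lambda>x. f x * f x) c + 2 * s * J (\<lambda>x. f x * g x) c
    + s\<^sup>2 * J (\<lambda>x. g x * g x) c" for s c
  define L where "L s c = J f c + s * J g c" for s c
  have pos_b: "0 \<le> Q s b + 2 * r * L s b + r\<^sup>2 * b" for s r
    unfolding Q_def L_def J_def by (rule q_integral0_square_nonneg) (use q bd in auto)
  have pos_a: "0 \<le> Q s a + 2 * r * L s a + r\<^sup>2 * a" for s r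
    unfolding Q_def L_def J_def by (rule q_integral0_square_nonneg) (use q bda in auto)
  have b: "(L s b)\<^sup>2 \<le> b * Q s b" for s
    using sq_le_mult_of_quadratic_nonneg[of "Q s b" "L s b" b] pos_b q by (simp add: mult.commute)
  have a: "(L s a)\<^sup>2 \<le> a * Q s a" for s
    using sq_le_mult_of_quadratic_nonneg[of "Q s a" "L s a" a] pos_a q by (simp add: mult.commute)
  have mixed: "2 * L s b * L s a \<le> b * Q s a + a * Q s b" for s
  proof -
    \<comment> \<open>Subtract the \<open>J\<^sub>b\<close>-mean from \<open>f + s g\<close> and integrate the square by \<open>J\<^sub>a\<close>.\<close>
    have "0 \<le> b * (Q s a + 2 * (- L s b / b) * L s a + (- L s b / b)\<^sup>2 * a)"
      using pos_a[of s "- L s b / b"] q by simp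
    also have "\<dots> = b * Q s a - 2 * L s b * L s a + a * (L s b)\<^sup>2 / b"
      using q by (simp add: field_simps power2_eq_square)
    also have "a * (L s b)\<^sup>2 / b \<le> a * Q s b"
      using mult_left_mono[OF b[of s], of a] q by (simp add: field_simps)
    finally show ?thesis by simp
  qed
  have quad: "0 \<le> V f + 2 * t * ((b - a) * (J (\<lambda>x. f x * g x) b - J (\<lambda>x. f x * g x) a)
            - (J f b - J f a) * (J g b - J g a)) + t\<^sup>2 * V g" (is "0 \<le> ?R") for t
  proof -
    have "?R = (b * Q t b - (L t b)\<^sup>2) + (a * Q t a - (L t a)\<^sup>2)
        + (b * Q (- t) a + a * Q (- t) b - 2 * L (- t) b * L (- t) a)"
      unfolding V_def Q_def L_def by (simp add: power2_eq_square algebra_simps)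
    then show ?thesis using b[of t] a[of t] mixed[of "- t"] by linarith
  qed
  have "0 \<le> V g"
    unfolding V_def J_def by (rule q_integral0_variance_nonneg) (use q bd in auto)
  with quad show ?thesis by (rule sq_le_mult_of_quadratic_nonneg)
qed

section \<open>The Gruess inequality\<close>

theorem theorem4p2:
  fixes q a b m M \<phi> \<Phi> :: real and f g :: "real \<Rightarrow> real"
  assumes "0 < q" and "q < 1"
    and "0 < a" and "a < b"
    and "bounded (f ` {0..b})" and "bounded (g ` {0..b})"
    and "\<And>x. x \<in> {0..b} \<Longrightarrow> m \<le> f x \<and> f x \<le> M"
    and "\<And>x. x \<in> {0..b} \<Longrightarrow> \<phi> \<le> g x \<and> g x \<le> \<Phi>"
  shows "\<bar>1 / (b - a) * q_integral q (\<lambda>x. f x * g x) a b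
           - 1 / (b - a)\<^sup>2 * q_integral q f a b * q_integral q g a b\<bar>
         \<le> 1 / 4 * (M - m) * (\<Phi> - \<phi>) * (1 + 4 * a * b / (b - a)\<^sup>2)"
proof -
  define V where "V h = (a + b) * (q_integral0 q (\<lambda>x. h x * h x) b + q_integral0 q (\<lambda>x. h x * h x) a)
    - (q_integral0 q h b + q_integral0 q h a)\<^sup>2" for h
  define T where "T = (b - a) * q_integral q (\<lambda>x. f x * g x) a b
    - q_integral q f a b * q_integral q g a b"
  define K where "K = (M - m) * (\<Phi> - \<phi>) * (a + b)\<^sup>2 / 4"
  have "m \<le> M" "\<phi> \<le> \<Phi>"
    using assms(3,4) assms(7,8)[of 0] by auto
  have Vf: "V f \<le> ((a + b) * (M - m) / 2)\<^sup>2"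
    unfolding V_def by (rule q_integral0_variance_le) (use assms in auto)
  have Vg: "V g \<le> ((a + b) * (\<Phi> - \<phi>) / 2)\<^sup>2"
    unfolding V_def by (rule q_integral0_variance_le) (use assms in auto)
  have "0 \<le> V g"
    unfolding V_def by (rule q_integral0_variance_nonneg) (use assms in auto)
  have "T\<^sup>2 \<le> V f * V g"
    unfolding T_def V_def q_integral_def
    by (rule covariance_sq_le_variance_mult) (use assms in auto)
  also have "\<dots> \<le> K\<^sup>2"
  proof -
    have "V f * V g \<le> ((a + b) * (M - m) / 2)\<^sup>2 * ((a + b) * (\<Phi> - \<phi>) / 2)\<^sup>2"
      using Vf Vg \<open>0 \<le> V g\<close> by (intro mult_mono) auto
    also have "\<dots> = K\<^sup>2"
      by (simp add: K_def power2_eq_square)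
    finally show ?thesis .
  qed
  finally have "\<bar>T\<bar> \<le> \<bar>K\<bar>"
    by (simp add: abs_le_square_iff)
  also have "\<bar>K\<bar> = K"
    using \<open>m \<le> M\<close> \<open>\<phi> \<le> \<Phi>\<close> by (simp add: K_def)
  finally have "\<bar>T\<bar> / (b - a)\<^sup>2 \<le> K / (b - a)\<^sup>2"
    by (rule divide_right_mono) simp
  moreover have "1 / (b - a) * q_integral q (\<lambda>x. f x * g x) a b
      - 1 / (b - a)\<^sup>2 * q_integral q f a b * q_integral q g a b = T / (b - a)\<^sup>2"
    using assms(4) by (simp add: T_def diff_divide_distrib power2_eq_square)
  moreover have "1 / 4 * (M - m) * (\<Phi> - \<phi>) * (1 + 4 * a * b / (b - a)\<^sup>2) = K / (b - a)\<^sup>2"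
  proof -
    have "(a + b)\<^sup>2 = (b - a)\<^sup>2 + 4 * a * b"
      by (simp add: power2_eq_square algebra_simps)
    then have "1 + 4 * a * b / (b - a)\<^sup>2 = (a + b)\<^sup>2 / (b - a)\<^sup>2"
      using assms(4) by (simp add: add_divide_distrib)
    then show ?thesis by (simp add: K_def)
  qed
  ultimately show ?thesis by simp
qed

end
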